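(* Let $A\in\mathbb{R}^{m\times n}$, $m\ge n$, have full column rank, let $\mathbf{b}\in\mathbb{R}^m$, let $W\in\mathbb{R}^{m\times m}$ be symmetric positive definite, and let $L\in\mathbb{R}^{n\times k}$, $k\le n$. Let $\|\cdot\|_G$ be a norm on the solution space $G=\mathbb{R}^k$ with dual norm $\|\cdot\|_{G^*}$. Then the condition number $\mathcal{K}$ of the weighted least squares solution map $g(A,\mathbf{b})=L^{\mathrm T}(A^{\mathrm T}WA)^{-1}A^{\mathrm T}W\mathbf{b}$ at $(A,\mathbf{b})$ (componentwise relative norm on the data, $\|\cdot\|_G$ on the solution) is $$\mathcal{K}=\max_{\|\mathbf{u}\|_{G^*}=1}\big\|[\,VD_A\ \ A_{W,I_n}^{\dagger}D_{\mathbf{b}}\,]^{\mathrm T}L\mathbf{u}\big\|_1=\big\|[\,VD_A\ \ A_{W,I_n}^{\dagger}D_{\mathbf{b}}\,]^{\mathrm T}L\big\|_{G^*,1},$$ where $$V=(A^{\mathrm T}WA)^{-1}\otimes\mathbf{d}^{\mathrm T}-\mathbf{x}^{\mathrm T}\otimes A_{W,I_n}^{\dagger}.$$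
   Context: Notation: $A_{W,I_n}^{\dagger}=(A^{\mathrm T}WA)^{-1}A^{\mathrm T}W$; $\mathbf{x}=A_{W,I_n}^{\dagger}\mathbf{b}$ is the unique minimizer of $(A\mathbf{x}-\mathbf{b})^{\mathrm T}W(A\mathbf{x}-\mathbf{b})$; $\mathbf{d}=W(\mathbf{b}-A\mathbf{x})$. $\mathrm{vec}(A)$ stacks the columns of $A$; $D_A=\mathrm{diag}(\mathrm{vec}(A))$ and $D_{\mathbf{b}}=\mathrm{diag}(\mathbf{b})$; $\otimes$ is the Kronecker product. Condition number: $W$ and $L$ are fixed and $g$ is a function of the data $(A,\mathbf{b})$. A perturbation $(\Delta A,\Delta\mathbf{b})\in\mathbb{R}^{m\times n}\times\mathbb{R}^m$ is admissible if each of its entries vanishes wherever the corresponding entry of $(A,\mathbf{b})$ vanishes. For admissible perturbations, $\|(\Delta A,\Delta\mathbf{b})\|_c=\min\{\omega:\ |\Delta A|\le\omega|A|,\ |\Delta\mathbf{b}|\le\omega|\mathbf{b}|\}$ (entrywise absolute values and inequalities). Then $\mathcal{K}=\max\{\|g'(A,\mathbf{b})\cdot(\Delta A,\Delta\mathbf{b})\|_G:\ (\Delta A,\Delta\mathbf{b})\text{ admissible},\ \|(\Delta A,\Delta\mathbf{b})\|_c=1\}$, where $g'$ is the Fréchet derivative. The dual norm is $\|\mathbf{u}\|_{G^*}=\max_{\mathbf{w}\ne0}\mathbf{u}^{\mathrm T}\mathbf{w}/\|\mathbf{w}\|_G$, and for a matrix $B$ with $k$ columns $\|B\|_{G^*,1}=\max_{\|\mathbf{u}\|_{G^*}=1}\|B\mathbf{u}\|_1$.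 *)

theory Defs
  imports "HOL-Analysis.Analysis"
begin

text \<open>
  The maximum of a set of reals is taken literally (a least upper bound that is attained).
  \<open>max_of S\<close> is meaningful only if \<open>has_max S\<close> holds.
\<close>

definition has_max :: "real set \<Rightarrow> bool" where
  "has_max S \<longleftrightarrow> (\<exists>M\<in>S. \<forall>y\<in>S. y \<le> M)"

definition max_of :: "real set \<Rightarrow> real" where
  "max_of S = (GREATEST M. M \<in> S)"

definition is_norm :: "('a::real_vector \<Rightarrow> real) \<Rightarrow> bool" where
  "is_norm G \<longleftrightarrow>
     (\<forall>x. 0 \<le> G x) \<and> (\<forall>x. G x = 0 \<longleftrightarrow> x = 0) \<and>
     (\<forall>c x. G (c *\<^sub>R x) = \<bar>c\<bar> * G x) \<and> (\<forall>x y. G (x + y) \<le> G x + G y)"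

definition dual_norm :: "(real^'k \<Rightarrow> real) \<Rightarrow> real^'k \<Rightarrow> real" where
  "dual_norm G u = max_of {(u \<bullet> w) / G w | w. w \<noteq> 0}"

definition l1_norm :: "real^'i \<Rightarrow> real" where
  "l1_norm v = (\<Sum>i\<in>UNIV. \<bar>v $ i\<bar>)"

definition dual_l1_opnorm :: "(real^'k \<Rightarrow> real) \<Rightarrow> real^'k^'i \<Rightarrow> real" where
  "dual_l1_opnorm G B = max_of {l1_norm (B *v u) | u. dual_norm G u = 1}"

definition sym_pos_def :: "real^'m^'m \<Rightarrow> bool" where
  "sym_pos_def W \<longleftrightarrow> transpose W = W \<and> (\<forall>v. v \<noteq> 0 \<longrightarrow> 0 < v \<bullet> (W *v v))"

definition diag :: "real^'i \<Rightarrow> real^'i^'i" where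
  "diag v = (\<chi> i j. if i = j then v $ i else 0)"

text \<open>
  Rows and columns of a Kronecker product are indexed by pairs, the index of the left factor first.
  Read lexicographically, this is the usual block ordering.
\<close>

definition kron :: "real^'c^'r \<Rightarrow> real^'d^'s \<Rightarrow> real^('c \<times> 'd)^('r \<times> 's)" where
  "kron A B = (\<chi> p q. A $ fst p $ fst q * B $ snd p $ snd q)"

text \<open>
  Column stacking: the entry in row \<open>i\<close> and column \<open>j\<close> of \<open>A\<close> has index \<open>(j, i)\<close>,
  so that in lexicographic order whole columns follow one another.
\<close>

definition vec_cols :: "real^'n^'m \<Rightarrow> real^('n \<times> 'm)" where
  "vec_cols A = (\<chi> q. A $ snd q $ fst q)"

text \<open>The block matrix \<open>[P Q]\<close>; its columns are indexed by the disjoint sum.\<close>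

definition hcat :: "real^'p^'r \<Rightarrow> real^'q^'r \<Rightarrow> real^('p + 'q)^'r" where
  "hcat P Q = (\<chi> i s. case s of Inl j \<Rightarrow> P $ i $ j | Inr j \<Rightarrow> Q $ i $ j)"

definition admissible ::
    "(real^'n^'m) \<times> (real^'m) \<Rightarrow> (real^'n^'m) \<times> (real^'m) \<Rightarrow> bool" where
  "admissible z \<delta> \<longleftrightarrow>
     (\<forall>i j. fst z $ i $ j = 0 \<longrightarrow> fst \<delta> $ i $ j = 0) \<and>
     (\<forall>i. snd z $ i = 0 \<longrightarrow> snd \<delta> $ i = 0)"

text \<open>The least \<open>\<omega>\<close> exists if \<open>z \<noteq> 0\<close> and \<open>\<delta>\<close> is admissible for \<open>z\<close>.\<close>

definition comp_norm ::
    "(real^'n^'m) \<times> (real^'m) \<Rightarrow> (real^'n^'m) \<times> (real^'m) \<Rightarrow> real" where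
  "comp_norm z \<delta> = (LEAST \<omega>.
     (\<forall>i j. \<bar>fst \<delta> $ i $ j\<bar> \<le> \<omega> * \<bar>fst z $ i $ j\<bar>) \<and>
     (\<forall>i. \<bar>snd \<delta> $ i\<bar> \<le> \<omega> * \<bar>snd z $ i\<bar>))"

definition cond_values ::
    "(real^'k \<Rightarrow> real) \<Rightarrow> ((real^'n^'m) \<times> (real^'m) \<Rightarrow> real^'k) \<Rightarrow>
     (real^'n^'m) \<times> (real^'m) \<Rightarrow> real set" where
  "cond_values G g z =
     {G (frechet_derivative g (at z) \<delta>) | \<delta>. admissible z \<delta> \<and> comp_norm z \<delta> = 1}"

definition cond_number ::
    "(real^'k \<Rightarrow> real) \<Rightarrow> ((real^'n^'m) \<times> (real^'m) \<Rightarrow> real^'k) \<Rightarrow>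
     (real^'n^'m) \<times> (real^'m) \<Rightarrow> real" where
  "cond_number G g z = max_of (cond_values G g z)"

definition wls_pinv :: "real^'m^'m \<Rightarrow> real^'n^'m \<Rightarrow> real^'m^'n" where
  "wls_pinv W A = matrix_inv (transpose A ** W ** A) ** transpose A ** W"

definition wls_sol :: "real^'m^'m \<Rightarrow> real^'n^'m \<Rightarrow> real^'m \<Rightarrow> real^'n" where
  "wls_sol W A b = wls_pinv W A *v b"

definition wls_resid :: "real^'m^'m \<Rightarrow> real^'n^'m \<Rightarrow> real^'m \<Rightarrow> real^'m" where
  "wls_resid W A b = W *v (b - A *v wls_sol W A b)"

definition wls_map ::
    "real^'m^'m \<Rightarrow> real^'k^'n \<Rightarrow> (real^'n^'m) \<times> (real^'m) \<Rightarrow> real^'k" where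
  "wls_map W L = (\<lambda>(A, b). transpose L *v
     ((matrix_inv (transpose A ** W ** A) ** transpose A ** W) *v b))"

text \<open>
  The two Kronecker products below have row index types \<open>'n \<times> 1\<close> and \<open>1 \<times> 'n\<close>;
  both are identified with \<open>'n\<close>, which makes the difference
  \<open>(A\<^sup>TWA)\<^sup>-\<^sup>1 \<otimes> d\<^sup>T - x\<^sup>T \<otimes> A\<^sup>\<dagger>\<close> well-typed.
\<close>

definition wls_V :: "real^'m^'m \<Rightarrow> real^'n^'m \<Rightarrow> real^'m \<Rightarrow> real^('n \<times> 'm)^'n" where
  "wls_V W A b = (\<chi> r q.
     kron (matrix_inv (transpose A ** W ** A)) (rowvector (wls_resid W A b) :: real^'m^1) $ (r, 1) $ q
     - kron (rowvector (wls_sol W A b) :: real^'n^1) (wls_pinv W A) $ (1, r) $ q)"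

definition wls_block ::
    "real^'m^'m \<Rightarrow> real^'n^'m \<Rightarrow> real^'m \<Rightarrow> real^(('n \<times> 'm) + 'm)^'n" where
  "wls_block W A b = hcat (wls_V W A b ** diag (vec_cols A)) (wls_pinv W A ** diag b)"

end

theory Submission
  imports Defs
begin

text \<open>
  The solution map is differentiable, since the Gram matrix \<open>A\<^sup>TWA\<close> is invertible, and its derivative
  is explicit. With \<open>x\<close>, \<open>d\<close> the solution and the weighted residual at \<open>(A, b)\<close>, the derivative in
  direction \<open>(\<Delta>A, \<Delta>b)\<close> is
  \<open>L\<^sup>T((A\<^sup>TWA)\<^sup>-\<^sup>1 \<Delta>A\<^sup>T d - A\<^sup>\<dagger> \<Delta>A x + A\<^sup>\<dagger> \<Delta>b) = L\<^sup>T [V A\<^sup>\<dagger>] (vec \<Delta>A, \<Delta>b)\<close>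
  (\<open>wls_map_has_derivative\<close>). The formula comes from writing the increment of the solution as the
  inverse of the perturbed Gram matrix times a polynomial that vanishes at \<open>(A, b)\<close>; continuity of
  the inverse is then enough.

  The admissible perturbations of componentwise size 1 are the data multiplied entrywise by vectors
  \<open>s\<close> of the cube \<open>[-1, 1]\<close>, and every vertex of the cube yields such a perturbation
  (\<open>unit_perturbation_factor\<close>, \<open>sign_perturbation\<close>). So the derivative only takes values \<open>M s\<close> with
  \<open>M = L\<^sup>T [V D\<^sub>A  A\<^sup>\<dagger> D\<^sub>b]\<close>, those at the vertices included, and \<open>\<K>\<close> is the maximum of \<open>\<parallel>M s\<parallel>\<close> over the cube, attained at a vertex.

  By duality \<open>\<parallel>M s\<parallel>\<close> is the maximum of \<open>u \<bullet> M s = M\<^sup>T u \<bullet> s\<close> over the dual unit sphere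
  (\<open>norm_attained_by_dual\<close>). Exchanging the two maxima and maximizing over \<open>s\<close> first gives
  \<open>s = sgn (M\<^sup>T u)\<close> and the value \<open>\<parallel>M\<^sup>T u\<parallel>\<^sub>1\<close> (\<open>sign_vector_duality\<close>).
\<close>

section \<open>Norms on \<open>\<real>\<^sup>k\<close> and duality\<close>

lemma max_of_eqI:
  assumes "M \<in> S" "\<And>y. y \<in> S \<Longrightarrow> y \<le> M"
  shows "max_of S = M"
  unfolding max_of_def by (rule Greatest_equality) (use assms in auto)

lemma is_normD:
  assumes "is_norm G"
  shows "0 \<le> G x" "G x = 0 \<longleftrightarrow> x = 0" "G (c *\<^sub>R x) = \<bar>c\<bar> * G x" "G (x + y) \<le> G x + G y"
  using assms unfolding is_norm_def by auto

lemma is_norm_continuous: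
  fixes G :: "'a::euclidean_space \<Rightarrow> real"
  assumes "is_norm G"
  shows "continuous_on UNIV G"
proof (rule convex_on_continuous)
  show "convex_on UNIV G"
  proof (rule convex_onI)
    fix t :: real and x y :: 'a
    assume "0 < t" "t < 1"
    then show "G ((1 - t) *\<^sub>R x + t *\<^sub>R y) \<le> (1 - t) * G x + t * G y"
      using is_normD(4)[OF assms, of "(1 - t) *\<^sub>R x" "t *\<^sub>R y"] by (simp add: is_normD(3)[OF assms])
  qed simp
qed simp

lemma is_norm_pos:
  assumes "is_norm G" "x \<noteq> 0"
  shows "0 < G x"
  using is_normD(1,2)[OF assms(1), of x] assms(2) by simp

lemma is_norm_normalize:
  assumes "is_norm G" "x \<noteq> 0"
  shows "G (x /\<^sub>R G x) = 1"
  using is_norm_pos[OF assms] by (simp add: is_normD(3)[OF assms(1)])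

text \<open>
  The unit sphere is closed because the norm is continuous, and bounded because the norm has a
  positive minimum on the Euclidean unit sphere.
\<close>

lemma is_norm_sphere:
  fixes G :: "'a::euclidean_space \<Rightarrow> real"
  assumes G: "is_norm G"
  shows "compact {x. G x = 1}" "{x. G x = 1} \<noteq> {}"
proof -
  obtain e :: 'a where e: "norm e = 1"
    by (rule vector_choose_size[OF zero_le_one])
  then have "e \<noteq> 0" by auto
  then have "G (e /\<^sub>R G e) = 1" by (rule is_norm_normalize[OF G])
  then show "{x. G x = 1} \<noteq> {}" by blast
  have "e \<in> sphere 0 1" using e by simp
  then have "sphere (0::'a) 1 \<noteq> {}" by (metis empty_iff)
  moreover have "continuous_on (sphere 0 1) G"
    by (rule continuous_on_subset[OF is_norm_continuous[OF G]]) simp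
  ultimately have "\<exists>m\<in>sphere 0 1. \<forall>y\<in>sphere 0 1. G m \<le> G y"
    by (intro continuous_attains_inf compact_sphere)
  then obtain m where m: "m \<in> sphere 0 1" "\<And>y. y \<in> sphere 0 1 \<Longrightarrow> G m \<le> G y" by blast
  have pos: "0 < G m" using m(1) by (intro is_norm_pos[OF G]) auto
  have "norm x \<le> 1 / G m" if "G x = 1" for x
  proof -
    have "x \<noteq> 0" using that is_normD(2)[OF G, of x] by auto
    then have "G m \<le> G (x /\<^sub>R norm x)" by (intro m(2)) auto
    also have "\<dots> = \<bar>inverse (norm x)\<bar> * G x" by (rule is_normD(3)[OF G])
    finally show ?thesis using that \<open>x \<noteq> 0\<close> pos by (simp add: pos_le_divide_eq inverse_eq_divide mult.commute)
  qed
  then have "bounded {x. G x = 1}" by (intro boundedI) auto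
  moreover have "closed {x. G x = 1}"
    by (rule closed_Collect_eq[OF is_norm_continuous[OF G] continuous_on_const])
  ultimately show "compact {x. G x = 1}" by (simp add: compact_eq_bounded_closed)
qed

text \<open>By homogeneity the quotient defining the dual norm only has to be maximized over the compact
  unit sphere; hence the maximum exists and a Hoelder-type inequality holds.\<close>

lemma dual_norm_attained:
  fixes u :: "real^'k"
  assumes G: "is_norm G"
  obtains w where "G w = 1" "dual_norm G u = u \<bullet> w" "\<And>v. u \<bullet> v \<le> dual_norm G u * G v"
proof -
  have "continuous_on {v. G v = 1} (\<lambda>v. u \<bullet> v)" by (intro continuous_intros)
  then obtain w where w: "G w = 1" "\<And>v. G v = 1 \<Longrightarrow> u \<bullet> v \<le> u \<bullet> w"
    using continuous_attains_sup[OF is_norm_sphere[OF G], of "\<lambda>v. u \<bullet> v"] by blast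
  have quot: "(u \<bullet> v) / G v \<le> u \<bullet> w" if "v \<noteq> 0" for v
    using w(2)[OF is_norm_normalize[OF G that]] by (simp add: divide_inverse mult.commute)
  have "w \<noteq> 0" using w(1) is_normD(2)[OF G, of w] by auto
  have eq: "dual_norm G u = u \<bullet> w"
    unfolding dual_norm_def
  proof (intro max_of_eqI)
    show "u \<bullet> w \<in> {(u \<bullet> v) / G v | v. v \<noteq> 0}"
      unfolding mem_Collect_eq using w(1) \<open>w \<noteq> 0\<close> by (intro exI[of _ w]) simp
  next
    fix q assume "q \<in> {(u \<bullet> v) / G v | v. v \<noteq> 0}"
    then obtain v where "v \<noteq> 0" "q = (u \<bullet> v) / G v" by auto
    then show "q \<le> u \<bullet> w" using quot by simp
  qed
  have hoelder: "u \<bullet> v \<le> dual_norm G u * G v" for v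
  proof (cases "v = 0")
    case True
    then show ?thesis using is_normD(2)[OF G, of v] by simp
  next
    case False
    then show ?thesis using quot[OF False] is_norm_pos[OF G False] eq by (simp add: pos_divide_le_eq)
  qed
  show ?thesis by (rule that[OF w(1) eq hoelder])
qed

lemma is_norm_dual_norm:
  fixes G :: "real^'k \<Rightarrow> real"
  assumes G: "is_norm G"
  shows "is_norm (dual_norm G)"
proof -
  have hoelder: "u \<bullet> v \<le> dual_norm G u * G v" for u v
    using dual_norm_attained[OF G, of u] by blast
  have le: "u \<bullet> v \<le> dual_norm G u" if "G v = 1" for u v
    using hoelder[of u v] that by simp
  have Gminus: "G (- v) = G v" for v
    using is_normD(3)[OF G, of "- 1" v] by simp
  have nonneg: "0 \<le> dual_norm G u" for u
  proof -
    obtain w where w: "G w = 1" "dual_norm G u = u \<bullet> w" by (rule dual_norm_attained[OF G])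
    then show ?thesis using le[of "- w" u] Gminus[of w] by simp
  qed
  have pos: "dual_norm G u = 0 \<longleftrightarrow> u = 0" for u
  proof
    assume 0: "dual_norm G u = 0"
    have "u \<bullet> u \<le> dual_norm G u * G u" by (rule hoelder)
    then show "u = 0" using 0 inner_ge_zero[of u] by simp
  next
    assume "u = 0"
    moreover obtain w where "dual_norm G u = u \<bullet> w" by (rule dual_norm_attained[OF G])
    ultimately show "dual_norm G u = 0" by simp
  qed
  have scale_le: "dual_norm G (c *\<^sub>R u) \<le> \<bar>c\<bar> * dual_norm G u" for c u
  proof -
    obtain w where w: "G w = 1" "dual_norm G (c *\<^sub>R u) = c *\<^sub>R u \<bullet> w"
      by (rule dual_norm_attained[OF G])
    have "c * (u \<bullet> w) \<le> \<bar>c\<bar> * \<bar>u \<bullet> w\<bar>" by (rule order_trans[OF abs_ge_self]) (simp add: abs_mult)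
    also have "\<dots> \<le> \<bar>c\<bar> * dual_norm G u"
      using le[of w u] le[of "- w" u] w(1) Gminus[of w] by (intro mult_left_mono) (auto simp: abs_if)
    finally show ?thesis using w(2) by simp
  qed
  \<comment> \<open>The reverse inequality is the same bound for the inverse scalar.\<close>
  have scale: "dual_norm G (c *\<^sub>R u) = \<bar>c\<bar> * dual_norm G u" for c u
  proof (cases "c = 0")
    case True
    then show ?thesis using pos[of 0] by simp
  next
    case False
    then have "dual_norm G u \<le> \<bar>inverse c\<bar> * dual_norm G (c *\<^sub>R u)"
      using scale_le[of "inverse c" "c *\<^sub>R u"] by simp
    then have "\<bar>c\<bar> * dual_norm G u \<le> dual_norm G (c *\<^sub>R u)"
      using False by (simp add: abs_inverse field_simps)
    then show ?thesis using scale_le[of c u] by linarith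
  qed
  have triangle: "dual_norm G (u + v) \<le> dual_norm G u + dual_norm G v" for u v
  proof -
    obtain w where w: "G w = 1" "dual_norm G (u + v) = (u + v) \<bullet> w"
      by (rule dual_norm_attained[OF G])
    then show ?thesis using le[of w u] le[of w v] by (simp add: inner_add_left)
  qed
  show ?thesis unfolding is_norm_def by (intro conjI allI nonneg pos scale triangle)
qed

text \<open>
  In finite dimensions a norm is the dual of its dual. The dual unit vector at \<open>y\<close> is a normal
  of a hyperplane that separates \<open>y\<close> from the open ball of radius \<open>G y\<close>.
\<close>

lemma norm_attained_by_dual:
  fixes y :: "real^'k"
  assumes G: "is_norm G"
  obtains u where "dual_norm G u = 1" "u \<bullet> y = G y"
proof (cases "y = 0")
  case True
  moreover obtain u where "dual_norm G u = 1"
    using is_norm_sphere(2)[OF is_norm_dual_norm[OF G]] by auto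
  moreover have "G 0 = 0" using is_normD(2)[OF G, of 0] by simp
  ultimately show ?thesis using that by simp
next
  case False
  note scale = is_normD(3)[OF G]
  have Gy: "0 < G y" using is_norm_pos[OF G False] .
  have "convex {x. G x < G y}"
  proof (rule convexI)
    fix a b and s t :: real
    assume ab: "a \<in> {x. G x < G y}" "b \<in> {x. G x < G y}" and st: "0 \<le> s" "0 \<le> t" "s + t = 1"
    have "G (s *\<^sub>R a + t *\<^sub>R b) \<le> s * G a + t * G b"
      using is_normD(4)[OF G, of "s *\<^sub>R a" "t *\<^sub>R b"] st by (simp add: scale)
    also have "\<dots> < G y" using ab st convex_bound_lt[of "G a" "G y" "G b" s t] by auto
    finally show "s *\<^sub>R a + t *\<^sub>R b \<in> {x. G x < G y}" by simp
  qed
  moreover have "0 \<in> {x. G x < G y}" using Gy scale[of 0 0] by simp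
  ultimately obtain a c where a: "a \<noteq> 0" "\<And>x. G x < G y \<Longrightarrow> a \<bullet> x \<le> c" "c \<le> a \<bullet> y"
    using separating_hyperplane_sets[of "{x. G x < G y}" "{y}"] by auto
  obtain w where w: "G w = 1" "dual_norm G a = a \<bullet> w" "\<And>v. a \<bullet> v \<le> dual_norm G a * G v"
    using dual_norm_attained[OF G, of a] by blast
  have apos: "0 < dual_norm G a" using is_norm_pos[OF is_norm_dual_norm[OF G] a(1)] .
  \<comment> \<open>The separation, tested at points \<open>t w\<close> of the ball, gives the reverse Hoelder inequality as \<open>t\<close>
    tends to \<open>G y\<close>.\<close>
  have "t * dual_norm G a \<le> a \<bullet> y" if "0 \<le> t" "t < G y" for t
    using a(2)[of "t *\<^sub>R w"] a(3) w(1,2) that by (simp add: scale)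
  then have "t \<le> a \<bullet> y / dual_norm G a" if "0 < t" "t < G y" for t
    using that apos by (simp add: pos_le_divide_eq)
  then have "G y \<le> a \<bullet> y / dual_norm G a" by (rule dense_le_bounded[OF Gy])
  then have "dual_norm G a * G y \<le> a \<bullet> y" using apos by (simp add: pos_le_divide_eq mult.commute)
  then have "a \<bullet> y = dual_norm G a * G y" using w(3)[of y] by simp
  then have "(a /\<^sub>R dual_norm G a) \<bullet> y = G y" using apos by simp
  then show ?thesis by (rule that[OF is_norm_normalize[OF is_norm_dual_norm[OF G] a(1)]])
qed

section \<open>Sign vectors\<close>

lemma inner_le_l1_norm:
  fixes v s :: "real^'i"
  assumes "\<And>i. \<bar>s $ i\<bar> \<le> 1"
  shows "v \<bullet> s \<le> l1_norm v"
  unfolding inner_vec_def l1_norm_def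
proof (rule sum_mono)
  fix i
  have "v $ i * s $ i \<le> \<bar>v $ i\<bar> * \<bar>s $ i\<bar>"
    using abs_ge_self[of "v $ i * s $ i"] by (simp only: abs_mult)
  also have "\<dots> \<le> \<bar>v $ i\<bar> * 1" using assms[of i] by (intro mult_left_mono) auto
  finally show "v $ i \<bullet> s $ i \<le> \<bar>v $ i\<bar>" by simp
qed

text \<open>
  For the norm of \<open>M s\<close> over the cube and the 1-norm of \<open>M\<^sup>T u\<close> over the dual sphere the maxima
  agree, since both are the maximum of the bilinear form \<open>u \<bullet> M s\<close>. A vertex \<open>s\<^sub>0\<close> of the cube
  suffices: take the signs of the maximal \<open>M\<^sup>T u\<^sub>0\<close>.
\<close>

lemma sign_vector_duality:
  fixes M :: "real^'i^'k"
  assumes G: "is_norm G"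
  obtains u0 s0 where "dual_norm G u0 = 1" "\<And>i. \<bar>s0 $ i\<bar> = 1"
    "G (M *v s0) = l1_norm (transpose M *v u0)"
    "\<And>u. dual_norm G u = 1 \<Longrightarrow> l1_norm (transpose M *v u) \<le> l1_norm (transpose M *v u0)"
    "\<And>s. (\<And>i. \<bar>s $ i\<bar> \<le> 1) \<Longrightarrow> G (M *v s) \<le> l1_norm (transpose M *v u0)"
proof -
  have adj: "u \<bullet> (M *v s) = (transpose M *v u) \<bullet> s" for u s
    by (simp add: dot_lmul_matrix[symmetric])
  have "continuous_on {u. dual_norm G u = 1} (\<lambda>u. l1_norm (transpose M *v u))"
    unfolding l1_norm_def matrix_vector_mult_def
    by (auto intro!: continuous_intros)
  then obtain u0 where u0: "dual_norm G u0 = 1"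
    "\<And>u. dual_norm G u = 1 \<Longrightarrow> l1_norm (transpose M *v u) \<le> l1_norm (transpose M *v u0)"
    using continuous_attains_sup[OF is_norm_sphere[OF is_norm_dual_norm[OF G]]] by auto
  have upper: "G (M *v s) \<le> l1_norm (transpose M *v u0)" if s: "\<And>i. \<bar>s $ i\<bar> \<le> 1" for s
  proof -
    obtain u where u: "dual_norm G u = 1" "u \<bullet> (M *v s) = G (M *v s)"
      using norm_attained_by_dual[OF G] by blast
    have "G (M *v s) \<le> l1_norm (transpose M *v u)"
      using inner_le_l1_norm[OF s] u(2) by (metis adj)
    then show ?thesis using u0(2)[OF u(1)] by linarith
  qed
  \<comment> \<open>Vanishing entries also get sign 1, so that every entry of the vertex has modulus 1.\<close>
  define s0 :: "real^'i" where "s0 = (\<chi> i. if 0 \<le> (transpose M *v u0) $ i then 1 else - 1)"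
  have s0: "\<bar>s0 $ i\<bar> = 1" for i by (simp add: s0_def)
  have "l1_norm (transpose M *v u0) = (transpose M *v u0) \<bullet> s0"
    unfolding l1_norm_def inner_vec_def s0_def by (intro sum.cong) auto
  also have "\<dots> = u0 \<bullet> (M *v s0)" by (simp add: adj)
  also have "\<dots> \<le> G (M *v s0)"
    using dual_norm_attained[OF G, of u0] u0(1) by force
  finally have "G (M *v s0) = l1_norm (transpose M *v u0)"
    using upper[of s0] s0 by (simp add: antisym)
  then show ?thesis using that u0 upper s0 by blast
qed

section \<open>Componentwise perturbations\<close>

text \<open>
  The data in the order of the columns of \<open>wls_block\<close>: the derivative becomes a single
  matrix-vector product, and perturbations are compared with the data entry by entry.
\<close>

definition pack :: "(real^'n^'m) \<times> (real^'m) \<Rightarrow> real^(('n \<times> 'm) + 'm)" where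
  "pack z = (\<chi> s. case s of Inl q \<Rightarrow> vec_cols (fst z) $ q | Inr i \<Rightarrow> snd z $ i)"

lemma pack_nth [simp]:
  "pack z $ Inl (j, i) = fst z $ i $ j" "pack z $ Inr i = snd z $ i"
  by (simp_all add: pack_def vec_cols_def)

lemma all_pack_iff:
  "(\<forall>s. P s (pack z $ s) (pack w $ s)) \<longleftrightarrow>
    (\<forall>i j. P (Inl (j, i)) (fst z $ i $ j) (fst w $ i $ j)) \<and> (\<forall>i. P (Inr i) (snd z $ i) (snd w $ i))"
  by (auto simp: split_sum_all)

lemma pack_eq_iff: "pack z = pack w \<longleftrightarrow> z = w"
  by (auto simp: vec_eq_iff all_pack_iff[of "\<lambda>_ x y. x = y"] prod_eq_iff)

lemma surj_pack:
  obtains z where "pack z = v"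
proof
  show "pack (\<chi> i j. v $ Inl (j, i), \<chi> i. v $ Inr i) = v"
    by (auto simp: vec_eq_iff split_sum_all)
qed

lemma hcat_mult_pack:
  "hcat P Q *v pack z = P *v vec_cols (fst z) + Q *v snd z"
proof -
  have "(\<Sum>s\<in>UNIV. hcat P Q $ r $ s * pack z $ s)
    = (\<Sum>q\<in>UNIV. P $ r $ q * vec_cols (fst z) $ q) + (\<Sum>i\<in>UNIV. Q $ r $ i * snd z $ i)" for r
    by (simp add: UNIV_Plus_UNIV[symmetric] sum.Plus hcat_def pack_def del: UNIV_Plus_UNIV)
  then show ?thesis by (simp add: vec_eq_iff matrix_vector_mult_def)
qed

lemma matrix_mult_diag_nth: "(P ** diag v) $ i $ j = P $ i $ j * v $ j"
proof -
  have "P $ i $ k * diag v $ k $ j = (if k = j then P $ i $ j * v $ j else 0)" for k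
    by (simp add: diag_def)
  then show ?thesis by (simp add: matrix_matrix_mult_def)
qed

lemma diag_mult_nth: "(diag v *v s) $ i = v $ i * s $ i"
proof -
  have "diag v $ i $ k * s $ k = (if k = i then v $ i * s $ i else 0)" for k
    by (simp add: diag_def)
  then show ?thesis by (simp add: matrix_vector_mult_def)
qed

lemma wls_block_eq: "wls_block W A b = hcat (wls_V W A b) (wls_pinv W A) ** diag (pack (A, b))"
  by (simp add: vec_eq_iff wls_block_def matrix_mult_diag_nth hcat_def pack_def split: sum.split)

lemma admissible_iff_pack: "admissible z \<delta> \<longleftrightarrow> (\<forall>s. pack z $ s = 0 \<longrightarrow> pack \<delta> $ s = 0)"
  unfolding admissible_def all_pack_iff[of "\<lambda>_ x y. x = 0 \<longrightarrow> y = 0"] ..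

lemma comp_norm_eq_pack:
  "comp_norm z \<delta> = (LEAST \<omega>. \<forall>s. \<bar>pack \<delta> $ s\<bar> \<le> \<omega> * \<bar>pack z $ s\<bar>)"
  unfolding comp_norm_def all_pack_iff[of "\<lambda>_ x y. \<bar>x\<bar> \<le> _ * \<bar>y\<bar>"] ..

text \<open>The least \<open>\<omega>\<close> is the maximal ratio \<open>|\<delta>\<^sub>s| / |z\<^sub>s|\<close> over the support of \<open>z\<close>; off the
  support both sides vanish by admissibility.\<close>

lemma comp_norm_bound:
  assumes "admissible z \<delta>"
  shows "\<bar>pack \<delta> $ s\<bar> \<le> comp_norm z \<delta> * \<bar>pack z $ s\<bar>"
proof (cases "pack z $ s = 0")
  case True
  then show ?thesis using assms by (simp add: admissible_iff_pack)
next
  case False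
  let ?R = "(\<lambda>s. \<bar>pack \<delta> $ s\<bar> / \<bar>pack z $ s\<bar>) ` {s. pack z $ s \<noteq> 0}"
  have fin: "finite ?R" by simp
  have "comp_norm z \<delta> = Max ?R"
    unfolding comp_norm_eq_pack
  proof (rule Least_equality)
    show "\<forall>s. \<bar>pack \<delta> $ s\<bar> \<le> Max ?R * \<bar>pack z $ s\<bar>"
    proof
      fix s
      show "\<bar>pack \<delta> $ s\<bar> \<le> Max ?R * \<bar>pack z $ s\<bar>"
      proof (cases "pack z $ s = 0")
        case True
        then show ?thesis using assms by (simp add: admissible_iff_pack)
      next
        case False
        then have "\<bar>pack \<delta> $ s\<bar> / \<bar>pack z $ s\<bar> \<le> Max ?R" by (intro Max_ge fin) auto
        then show ?thesis using False by (simp add: field_simps)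
      qed
    qed
  next
    fix \<omega> assume \<omega>: "\<forall>s. \<bar>pack \<delta> $ s\<bar> \<le> \<omega> * \<bar>pack z $ s\<bar>"
    then show "Max ?R \<le> \<omega>"
      using False by (intro Max.boundedI fin) (auto simp: divide_le_eq)
  qed
  moreover have "\<bar>pack \<delta> $ s\<bar> / \<bar>pack z $ s\<bar> \<le> Max ?R" using False by (intro Max_ge fin) auto
  ultimately show ?thesis using False by (simp add: field_simps)
qed

text \<open>The factor is the entrywise quotient of perturbation and data. Its default value \<open>0 / 0 = 0\<close>
  off the support of the data fits because an admissible perturbation vanishes there.\<close>

lemma unit_perturbation_factor:
  assumes "admissible z \<delta>" "comp_norm z \<delta> = 1"
  obtains s where "\<And>i. \<bar>s $ i\<bar> \<le> 1" "pack \<delta> = diag (pack z) *v s"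
proof
  let ?s = "\<chi> i. pack \<delta> $ i / pack z $ i"
  have le: "\<bar>pack \<delta> $ i\<bar> \<le> \<bar>pack z $ i\<bar>" for i using comp_norm_bound[OF assms(1), of i] assms(2) by simp
  then show "\<bar>?s $ i\<bar> \<le> 1" for i by (auto simp: abs_divide divide_le_eq_1)
  have "pack z $ i = 0 \<longrightarrow> pack \<delta> $ i = 0" for i using le[of i] by auto
  then show "pack \<delta> = diag (pack z) *v ?s" by (simp add: vec_eq_iff diag_mult_nth)
qed

text \<open>A nonzero entry of the data is needed here: it is what forces \<open>\<omega> \<ge> 1\<close>.\<close>

lemma sign_perturbation:
  assumes "z \<noteq> 0" "\<And>i. \<bar>s $ i\<bar> = 1" "pack \<delta> = diag (pack z) *v s"
  shows "admissible z \<delta>" "comp_norm z \<delta> = 1"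
proof -
  have eq: "pack \<delta> $ i = pack z $ i * s $ i" for i using assms(3) by (simp add: diag_mult_nth)
  then show "admissible z \<delta>" by (simp add: admissible_iff_pack)
  have "pack z \<noteq> pack 0" using assms(1) by (simp add: pack_eq_iff)
  moreover have "pack (0 :: (real^'a^'b) \<times> (real^'b)) = 0"
    by (auto simp: vec_eq_iff split_sum_all)
  ultimately obtain i where i: "pack z $ i \<noteq> 0" by (metis vec_eq_iff zero_index)
  show "comp_norm z \<delta> = 1"
    unfolding comp_norm_eq_pack eq abs_mult assms(2)
  proof (rule Least_equality)
    fix \<omega> assume "\<forall>s. \<bar>pack z $ s\<bar> * 1 \<le> \<omega> * \<bar>pack z $ s\<bar>"
    then have "\<bar>pack z $ i\<bar> * 1 \<le> \<omega> * \<bar>pack z $ i\<bar>" by blast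
    then show "1 \<le> \<omega>" using i by simp
  qed simp
qed

section \<open>The derivative of the weighted least squares solution\<close>

lemma matrix_inv_mult:
  fixes M :: "real^'n^'n"
  assumes "det M \<noteq> 0"
  shows "M ** matrix_inv M = mat 1" "matrix_inv M ** M = mat 1"
proof -
  have "\<exists>M'. M ** M' = mat 1 \<and> M' ** M = mat 1"
    using assms by (simp add: invertible_det_nz[symmetric] invertible_def)
  then have "M ** matrix_inv M = mat 1 \<and> matrix_inv M ** M = mat 1"
    unfolding matrix_inv_def by (rule someI_ex)
  then show "M ** matrix_inv M = mat 1" "matrix_inv M ** M = mat 1" by auto
qed

lemma tendsto_det:
  fixes M :: "'a \<Rightarrow> real^'n^'n"
  assumes "(M \<longlongrightarrow> N) F"
  shows "((\<lambda>t. det (M t)) \<longlongrightarrow> det N) F"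
  unfolding det_def by (intro tendsto_intros assms)

lemma matrix_inv_cramer:
  fixes M :: "real^'n^'n"
  assumes "det M \<noteq> 0"
  shows "matrix_inv M $ k $ l = det (\<chi> i j. if j = k then axis l 1 $ i else M $ i $ j) / det M"
proof -
  have "M *v (matrix_inv M *v axis l 1) = axis l 1"
    by (simp add: matrix_vector_mul_assoc matrix_inv_mult[OF assms])
  then have "(matrix_inv M *v axis l 1) $ k
    = det (\<chi> i j. if j = k then axis l 1 $ i else M $ i $ j) / det M"
    unfolding cramer[OF assms] by simp
  then show ?thesis by (simp add: matrix_vector_mult_basis column_def)
qed

lemma tendsto_matrix_inv:
  fixes M :: "'a \<Rightarrow> real^'n^'n"
  assumes M: "(M \<longlongrightarrow> N) F" and N: "det N \<noteq> 0"
  shows "((\<lambda>t. matrix_inv (M t)) \<longlongrightarrow> matrix_inv N) F"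
proof (intro vec_tendstoI)
  fix k l
  let ?D = "\<lambda>B. (\<chi> i j. if j = k then axis l 1 $ i else B $ i $ j) :: real^'n^'n"
  have "((\<lambda>t. ?D (M t)) \<longlongrightarrow> ?D N) F"
  proof (intro vec_tendstoI)
    fix i j
    show "((\<lambda>t. ?D (M t) $ i $ j) \<longlongrightarrow> ?D N $ i $ j) F"
      by (cases "j = k") (auto intro!: tendsto_intros M)
  qed
  then have "((\<lambda>t. det (?D (M t)) / det (M t)) \<longlongrightarrow> det (?D N) / det N) F"
    by (intro tendsto_divide tendsto_det M N)
  moreover have "\<forall>\<^sub>F t in F. det (?D (M t)) / det (M t) = matrix_inv (M t) $ k $ l"
    using tendsto_imp_eventually_ne[OF tendsto_det[OF M] N]
    by eventually_elim (simp add: matrix_inv_cramer)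
  ultimately show "((\<lambda>t. matrix_inv (M t) $ k $ l) \<longlongrightarrow> matrix_inv N $ k $ l) F"
    using matrix_inv_cramer[OF N] by (simp add: tendsto_cong)
qed

text \<open>
  A product rule that asks only for continuity of the first factor, at the price of a zero of the
  second: \<open>f y h y - f z h' (y - z) = f y (h y - h' (y - z)) + (f y - f z) h' (y - z)\<close>, where the first term
  is small because \<open>h z = 0\<close>, the second because \<open>f y - f z\<close> only meets a factor \<open>O(y - z)\<close>.
\<close>

lemma (in bounded_bilinear) has_derivative_mult_vanishing:
  assumes f: "(f \<longlongrightarrow> f z) (at z)" and h: "(h has_derivative h') (at z)" and z: "h z = 0"
  shows "((\<lambda>y. prod (f y) (h y)) has_derivative (\<lambda>d. prod (f z) (h' d))) (at z)"
proof (rule has_derivativeI)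
  have lin: "bounded_linear h'" using h by (rule has_derivative_bounded_linear)
  then show "bounded_linear (\<lambda>d. prod (f z) (h' d))"
    using bounded_linear_compose[OF bounded_linear_right lin] by simp
  have "((\<lambda>y. (h y - h' (y - z)) /\<^sub>R norm (y - z)) \<longlongrightarrow> 0) (at z)"
    using h z by (simp add: has_derivative_at_within)
  then have 1: "((\<lambda>y. prod (f y) ((h y - h' (y - z)) /\<^sub>R norm (y - z))) \<longlongrightarrow> prod (f z) 0) (at z)"
    by (intro tendsto f)
  have 2: "((\<lambda>y. prod (f y - f z) (h' (y - z) /\<^sub>R norm (y - z))) \<longlongrightarrow> 0) (at z)"
  proof -
    obtain K where K: "\<And>a b. norm (prod a b) \<le> norm a * norm b * K" "0 \<le> K"
      using nonneg_bounded by blast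
    obtain C where C: "\<And>d. norm (h' d) \<le> norm d * C" "0 \<le> C"
      using bounded_linear.nonneg_bounded[OF lin] by blast
    have "norm (prod (f y - f z) (h' (y - z) /\<^sub>R norm (y - z))) \<le> norm (f y - f z) * C * K" for y
    proof -
      have "norm (h' (y - z) /\<^sub>R norm (y - z)) \<le> C"
        using C(1)[of "y - z"] C(2) by (cases "y = z") (auto simp: field_simps)
      then have "norm (f y - f z) * norm (h' (y - z) /\<^sub>R norm (y - z)) * K \<le> norm (f y - f z) * C * K"
        using K(2) by (intro mult_right_mono mult_left_mono) auto
      then show ?thesis using K(1) order_trans by blast
    qed
    then have "\<forall>\<^sub>F y in at z. norm (prod (f y - f z) (h' (y - z) /\<^sub>R norm (y - z)))
        \<le> norm (f y - f z) * C * K" by simp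
    moreover have "((\<lambda>y. norm (f y - f z)) \<longlongrightarrow> 0) (at z)"
      using f by (simp add: LIM_zero tendsto_norm_zero)
    then have "((\<lambda>y. norm (f y - f z) * C * K) \<longlongrightarrow> 0) (at z)"
      by (intro tendsto_mult_left_zero)
    ultimately show ?thesis by (rule Lim_null_comparison)
  qed
  have "prod (f y) ((h y - h' (y - z)) /\<^sub>R norm (y - z)) + prod (f y - f z) (h' (y - z) /\<^sub>R norm (y - z))
    = (prod (f y) (h y) - prod (f z) (h z) - prod (f z) (h' (y - z))) /\<^sub>R norm (y - z)" for y
    by (simp add: z zero_right diff_left diff_right scaleR_right scaleR_diff_right)
  then show "((\<lambda>y. (prod (f y) (h y) - prod (f z) (h z) - prod (f z) (h' (y - z))) /\<^sub>R norm (y - z))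
      \<longlongrightarrow> 0) (at z)"
    using tendsto_add[OF 1 2] by (simp add: zero_right)
qed

lemma bounded_bilinear_matrix_vector_mult:
  "bounded_bilinear ((*v) :: real^'n^'m \<Rightarrow> real^'n \<Rightarrow> real^'m)"
  unfolding bilinear_conv_bounded_bilinear[symmetric] bilinear_def
  by (auto intro!: linearI simp: algebra_simps scaleR_matrix_vector_assoc matrix_vector_mult_scaleR)

lemma bounded_bilinear_transpose_vector_mult:
  "bounded_bilinear (\<lambda>(B :: real^'n^'m) v. transpose B *v v)"
proof -
  have "linear (\<lambda>B :: real^'n^'m. transpose B)"
    by (rule linearI) (simp_all add: transpose_def vec_eq_iff)
  then have "bounded_linear (\<lambda>B :: real^'n^'m. transpose B)" by (simp add: linear_linear)
  then show ?thesis
    by (rule bounded_bilinear.comp1[OF bounded_bilinear_matrix_vector_mult])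
qed

text \<open>The identity \<open>vec (P D Q) = (Q\<^sup>T \<otimes> P) vec D\<close> in the two cases that occur in \<open>V\<close>; the factor
  \<open>D\<^sup>T d\<close> is the transposed row \<open>d\<^sup>T D\<close>.\<close>

lemma wls_V_mult_vec_cols:
  "wls_V W A b *v vec_cols D =
    matrix_inv (transpose A ** W ** A) *v (transpose D *v wls_resid W A b)
    - wls_pinv W A *v (D *v wls_sol W A b)"
proof -
  let ?P = "matrix_inv (transpose A ** W ** A)" and ?Q = "wls_pinv W A"
  let ?d = "wls_resid W A b" and ?x = "wls_sol W A b"
  have "(\<Sum>q\<in>UNIV. wls_V W A b $ r $ q * vec_cols D $ q)
      = (\<Sum>j\<in>UNIV. \<Sum>i\<in>UNIV. ?P $ r $ j * (D $ i $ j * ?d $ i) - ?Q $ r $ i * (D $ i $ j * ?x $ j))" for r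
    unfolding UNIV_Times_UNIV[symmetric] sum.cartesian_product
    by (intro sum.cong)
      (auto simp: wls_V_def kron_def rowvector_def vec_cols_def algebra_simps)
  also have "\<dots> r = (\<Sum>j\<in>UNIV. \<Sum>i\<in>UNIV. ?P $ r $ j * (D $ i $ j * ?d $ i))
      - (\<Sum>i\<in>UNIV. \<Sum>j\<in>UNIV. ?Q $ r $ i * (D $ i $ j * ?x $ j))" for r
    unfolding sum_subtractf
    by (subst (3) sum.swap) (rule refl)
  finally show ?thesis
    by (simp add: vec_eq_iff matrix_vector_mult_def transpose_def sum_distrib_left)
qed

text \<open>
  Let \<open>x\<close> be the solution at \<open>(A, b)\<close>. The normal equations at nearby data \<open>(A', b')\<close> give
  \<open>x' - x = (A'\<^sup>TWA')\<^sup>-\<^sup>1 A'\<^sup>TW(b' - A'x)\<close>. The second factor is a polynomial that vanishes at \<open>(A, b)\<close>,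
  so that the inverse does not have to be differentiated.
\<close>

lemma wls_map_has_derivative:
  fixes A :: "real^'n^'m" and W :: "real^'m^'m" and L :: "real^'k^'n"
  assumes det: "det (transpose A ** W ** A) \<noteq> 0"
  shows "(wls_map W L has_derivative
    (\<lambda>\<delta>. transpose L *v (hcat (wls_V W A b) (wls_pinv W A) *v pack \<delta>))) (at (A, b))"
proof -
  let ?z = "(A, b)" and ?x = "wls_sol W A b"
  define N where "N z = transpose (fst z) ** W ** fst z" for z :: "(real^'n^'m) \<times> (real^'m)"
  define h where "h z = transpose (fst z) *v (W *v (snd z - fst z *v ?x))"
    for z :: "(real^'n^'m) \<times> (real^'m)"
  define h' where "h' \<delta> = transpose A *v (W *v (snd \<delta> - fst \<delta> *v ?x))
    + transpose (fst \<delta>) *v wls_resid W A b" for \<delta> :: "(real^'n^'m) \<times> (real^'m)"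
  have sol: "wls_sol W (fst z) (snd z) = matrix_inv (N z) *v (transpose (fst z) *v (W *v snd z))" for z
    by (simp add: wls_sol_def wls_pinv_def N_def matrix_vector_mul_assoc matrix_mul_assoc)
  have h_eq: "h z = transpose (fst z) *v (W *v snd z) - N z *v ?x" for z
    by (simp add: h_def N_def matrix_vector_mult_diff_distrib matrix_vector_mul_assoc matrix_mul_assoc)
  have Nz: "N ?z = transpose A ** W ** A" by (simp add: N_def)
  have "N ?z *v ?x = transpose A *v (W *v b)"
    using sol[of ?z] det by (simp add: Nz matrix_vector_mul_assoc matrix_mul_assoc matrix_inv_mult)
  then have hz: "h ?z = 0" by (simp add: h_eq)

  have lin: "((\<lambda>z. W *v (snd z - fst z *v ?x)) has_derivative
      (\<lambda>\<delta>. W *v (snd \<delta> - fst \<delta> *v ?x))) (at ?z)"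
  proof -
    have "bounded_linear (\<lambda>z :: (real^'n^'m) \<times> (real^'m). W *v (snd z - fst z *v ?x))"
      unfolding linear_conv_bounded_linear[symmetric]
      by (rule linearI) (simp_all add: algebra_simps scaleR_matrix_vector_assoc[symmetric] matrix_vector_mult_scaleR)
    then show ?thesis by (rule bounded_linear_imp_has_derivative)
  qed
  have der: "(h has_derivative h') (at ?z)"
    using bounded_bilinear.FDERIV[OF bounded_bilinear_transpose_vector_mult
        has_derivative_fst[OF has_derivative_ident] lin]
    unfolding h_def[abs_def] h'_def[abs_def] wls_resid_def by simp

  have tN: "(N \<longlongrightarrow> N ?z) (at ?z)"
  proof (intro vec_tendstoI)
    fix i j
    have fst: "((\<lambda>z. fst z) \<longlongrightarrow> fst ?z) (at ?z)" by (intro tendsto_fst tendsto_ident_at)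
    have N_nth: "N z $ i $ j = (\<Sum>k\<in>UNIV. (\<Sum>l\<in>UNIV. fst z $ l $ i * W $ l $ k) * fst z $ k $ j)" for z
      by (simp add: N_def matrix_matrix_mult_def transpose_def)
    then show "((\<lambda>z. N z $ i $ j) \<longlongrightarrow> N ?z $ i $ j) (at ?z)"
      unfolding N_nth by (intro tendsto_intros fst)
  qed
  have detN: "det (N ?z) \<noteq> 0" using det by (simp add: Nz)
  have "((\<lambda>z. matrix_inv (N z) *v h z) has_derivative (\<lambda>\<delta>. matrix_inv (N ?z) *v h' \<delta>)) (at ?z)"
    by (rule bounded_bilinear.has_derivative_mult_vanishing[OF bounded_bilinear_matrix_vector_mult
          tendsto_matrix_inv[OF tN detN] der hz])
  moreover have "matrix_inv (N ?z) *v h' \<delta> = hcat (wls_V W A b) (wls_pinv W A) *v pack \<delta>" for \<delta>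
    unfolding hcat_mult_pack wls_V_mult_vec_cols h'_def Nz
    by (simp add: wls_pinv_def algebra_simps matrix_vector_mul_assoc matrix_mul_assoc)
  ultimately have "((\<lambda>z. matrix_inv (N z) *v h z) has_derivative
      (\<lambda>\<delta>. hcat (wls_V W A b) (wls_pinv W A) *v pack \<delta>)) (at ?z)" by simp
  then have der_sol: "((\<lambda>z. transpose L *v (?x + matrix_inv (N z) *v h z)) has_derivative
      (\<lambda>\<delta>. transpose L *v (0 + hcat (wls_V W A b) (wls_pinv W A) *v pack \<delta>))) (at ?z)"
    by (intro bounded_linear.has_derivative[OF matrix_vector_mul_bounded_linear]
        has_derivative_add has_derivative_const)
  have eq: "transpose L *v (?x + matrix_inv (N z) *v h z) = wls_map W L z" if "det (N z) \<noteq> 0" for z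
  proof -
    have "wls_sol W (fst z) (snd z) = ?x + matrix_inv (N z) *v h z"
      unfolding sol h_eq using matrix_inv_mult[OF that]
      by (simp add: algebra_simps matrix_vector_mul_assoc)
    then show ?thesis by (cases z) (simp add: wls_map_def wls_sol_def wls_pinv_def)
  qed
  have "\<forall>\<^sub>F z in at ?z. det (N z) \<noteq> 0"
    by (rule tendsto_imp_eventually_ne[OF tendsto_det[OF tN] detN])
  then have "\<forall>\<^sub>F z in at ?z. transpose L *v (?x + matrix_inv (N z) *v h z) = wls_map W L z"
    by (rule eventually_mono) (rule eq)
  then have "(wls_map W L has_derivative
      (\<lambda>\<delta>. transpose L *v (0 + hcat (wls_V W A b) (wls_pinv W A) *v pack \<delta>))) (at ?z)"
    by (rule has_derivative_transform_eventually[OF der_sol]) (simp_all only: eq[OF detN] UNIV_I)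
  then show ?thesis by simp
qed

lemma det_gram_nonzero:
  fixes A :: "real^'n^'m"
  assumes "rank A = CARD('n)" "sym_pos_def W"
  shows "det (transpose A ** W ** A) \<noteq> 0"
proof -
  have "y = 0" if "(transpose A ** W ** A) *v y = 0" for y
  proof -
    have "(A *v y) \<bullet> (W *v (A *v y)) = y \<bullet> ((transpose A ** W ** A) *v y)"
      using dot_lmul_matrix[of y "transpose A" "W *v (A *v y)"]
      by (simp add: matrix_vector_mul_assoc[symmetric])
    also have "\<dots> = 0" using that by simp
    finally have "A *v y = 0" using assms(2) unfolding sym_pos_def_def by force
    then show "y = 0"
      using assms(1) by (metis full_rank_injective inj_eq matrix_vector_mult_0_right)
  qed
  then show ?thesis
    by (metis invertible_det_nz invertible_left_inverse matrix_left_invertible_ker)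
qed

section \<open>The condition number\<close>

theorem theorem5:
  fixes A :: "real^'n^'m" and b :: "real^'m" and W :: "real^'m^'m"
    and L :: "real^'k^'n" and G :: "real^'k \<Rightarrow> real"
  assumes "CARD('n) \<le> CARD('m)"
    and "rank A = CARD('n)"
    and "sym_pos_def W"
    and "CARD('k) \<le> CARD('n)"
    and "is_norm G"
  shows "wls_map W L differentiable (at (A, b)) \<and>
    has_max (cond_values G (wls_map W L) (A, b)) \<and>
    has_max {l1_norm (transpose (wls_block W A b) *v (L *v u)) | u. dual_norm G u = 1} \<and>
    cond_number G (wls_map W L) (A, b)
      = max_of {l1_norm (transpose (wls_block W A b) *v (L *v u)) | u. dual_norm G u = 1} \<and>
    max_of {l1_norm (transpose (wls_block W A b) *v (L *v u)) | u. dual_norm G u = 1}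
      = dual_l1_opnorm G (transpose (wls_block W A b) ** L)"
proof -
  let ?z = "(A, b)" and ?g = "wls_map W L"
  let ?S = "{l1_norm (transpose (wls_block W A b) *v (L *v u)) | u. dual_norm G u = 1}"
  define M where "M = transpose L ** wls_block W A b"
  have Mt: "transpose M *v u = transpose (wls_block W A b) *v (L *v u)" for u
    by (simp add: M_def matrix_transpose_mul matrix_vector_mul_assoc)
  have der: "(?g has_derivative (\<lambda>\<delta>. transpose L *v (hcat (wls_V W A b) (wls_pinv W A) *v pack \<delta>))) (at ?z)"
    by (rule wls_map_has_derivative[OF det_gram_nonzero[OF assms(2,3)]])
  have deriv: "frechet_derivative ?g (at ?z) \<delta> = M *v s" if "pack \<delta> = diag (pack ?z) *v s" for \<delta> s
    unfolding frechet_derivative_at[OF der, symmetric] that M_def wls_block_eq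
    by (simp add: matrix_vector_mul_assoc matrix_mul_assoc)
  have "A \<noteq> 0" using assms(2) by (auto simp: rank_0)
  then have nz: "?z \<noteq> 0" by (simp add: zero_prod_def)

  obtain u0 s0 where u0: "dual_norm G u0 = 1" and s0: "\<And>i. \<bar>s0 $ i\<bar> = 1"
    and eq: "G (M *v s0) = l1_norm (transpose M *v u0)"
    and max_u: "\<And>u. dual_norm G u = 1 \<Longrightarrow> l1_norm (transpose M *v u) \<le> l1_norm (transpose M *v u0)"
    and max_s: "\<And>s. (\<And>i. \<bar>s $ i\<bar> \<le> 1) \<Longrightarrow> G (M *v s) \<le> l1_norm (transpose M *v u0)"
    using sign_vector_duality[OF assms(5), of M] by blast
  let ?K = "l1_norm (transpose M *v u0)"

  obtain \<delta>0 where \<delta>0: "pack \<delta>0 = diag (pack ?z) *v s0" using surj_pack by blast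
  have K1: "?K \<in> cond_values G ?g ?z"
    unfolding cond_values_def mem_Collect_eq
    using sign_perturbation[OF nz s0 \<delta>0] deriv[OF \<delta>0] eq by (intro exI[of _ \<delta>0]) simp
  have K2: "y \<le> ?K" if "y \<in> cond_values G ?g ?z" for y
  proof -
    obtain \<delta> where \<delta>: "admissible ?z \<delta>" "comp_norm ?z \<delta> = 1" "y = G (frechet_derivative ?g (at ?z) \<delta>)"
      using \<open>y \<in> _\<close> unfolding cond_values_def by blast
    obtain s where "\<And>i. \<bar>s $ i\<bar> \<le> 1" "pack \<delta> = diag (pack ?z) *v s"
      using unit_perturbation_factor[OF \<delta>(1,2)] by blast
    then show ?thesis using max_s deriv \<delta>(3) by metis
  qed
  have K3: "?K \<in> ?S" using u0 Mt by auto
  have K4: "y \<le> ?K" if "y \<in> ?S" for y using that max_u Mt by auto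

  have "cond_number G ?g ?z = ?K" unfolding cond_number_def by (rule max_of_eqI[OF K1 K2])
  moreover have "max_of ?S = ?K" by (rule max_of_eqI[OF K3 K4])
  moreover have "max_of ?S = dual_l1_opnorm G (transpose (wls_block W A b) ** L)"
    by (simp add: dual_l1_opnorm_def matrix_vector_mul_assoc)
  moreover have "?g differentiable (at ?z)" using der by (rule differentiableI)
  ultimately show ?thesis unfolding has_max_def using K1 K2 K3 K4 by auto
qed

end
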